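(* Let $n\ge 3$ be an integer with $n\ne 6$. If there exists a symmetric Hadamard matrix of order $2n-2$ with all diagonal entries equal to $1$, then $$R(B_{n-2},B_n)\ge 4n-3.$$
   Context: For a positive integer $n$, the book graph $B_n=K_2+\overline{K}_n$ is the graph consisting of $n$ triangles sharing a common edge. The Ramsey number $R(B_m,B_n)$ is the smallest integer $N$ such that every red/blue coloring of the edges of $K_N$ contains a red copy of $B_m$ or a blue copy of $B_n$ (copies are as not necessarily induced subgraphs). A Hadamard matrix of order $N$ is an $N\times N$ matrix $H=(h_{ij})$ with all $h_{ij}\in\{+1,-1\}$ and $HH^{\mathsf T}=NI$; it is symmetric if $H=H^{\mathsf T}$. *)

theory Defs
  imports "HOL-Library.Ramsey" "Jordan_Normal_Form.Matrix"
begin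

text \<open>A simple graph is a pair of a vertex set \<open>V\<close> and an edge set contained in \<open>[V]\<^bsup>2\<^esup>\<close>, the set of
  two-element subsets of \<open>V\<close>.\<close>

type_synonym 'a sgraph = "'a set \<times> 'a set set"

definition complete_sgraph :: "nat \<Rightarrow> nat sgraph" where
  "complete_sgraph n = ({..<n}, [{..<n}]\<^bsup>2\<^esup>)"

definition complement_sgraph :: "'a sgraph \<Rightarrow> 'a sgraph" where
  "complement_sgraph G = (fst G, [fst G]\<^bsup>2\<^esup> - snd G)"

definition join_sgraph :: "'a sgraph \<Rightarrow> 'b sgraph \<Rightarrow> ('a + 'b) sgraph" where
  "join_sgraph G H =
    (fst G <+> fst H,
     (\<lambda>e. Inl ` e) ` snd G \<union> (\<lambda>e. Inr ` e) ` snd H \<union> {{Inl u, Inr v} | u v. u \<in> fst G \<and> v \<in> fst H})"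

definition book_sgraph :: "nat \<Rightarrow> (nat + nat) sgraph" where
  "book_sgraph n = join_sgraph (complete_sgraph 2) (complement_sgraph (complete_sgraph n))"

definition contains_copy :: "'a sgraph \<Rightarrow> 'b sgraph \<Rightarrow> bool" where
  "contains_copy G H \<longleftrightarrow> (\<exists>f. inj_on f (fst H) \<and> f ` fst H \<subseteq> fst G \<and> (\<forall>e \<in> snd H. f ` e \<in> snd G))"

text \<open>A red/blue colouring of the edges of a complete graph is given by its set \<open>Red\<close> of red edges; the
  blue graph is the complement of the red one.\<close>

definition ramsey_property :: "nat \<Rightarrow> 'a sgraph \<Rightarrow> 'b sgraph \<Rightarrow> bool" where
  "ramsey_property N G H \<longleftrightarrow>
    (\<forall>Red \<subseteq> snd (complete_sgraph N).
       contains_copy ({..<N}, Red) G \<or> contains_copy (complement_sgraph ({..<N}, Red)) H)"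

definition ramsey_number :: "'a sgraph \<Rightarrow> 'b sgraph \<Rightarrow> nat" where
  "ramsey_number G H = (LEAST N. ramsey_property N G H)"

text \<open>The minimum is attained for finite graphs, so the \<open>LEAST\<close> above is never taken over an empty set
  for them.\<close>

lemma contains_copy_of_clique:
  assumes "finite (fst H)" "snd H \<subseteq> [fst H]\<^bsup>2\<^esup>" "K \<subseteq> fst G" "finite K" "card K = card (fst H)"
    "[K]\<^bsup>2\<^esup> \<subseteq> snd G"
  shows "contains_copy G H"
proof -
  obtain f where f: "bij_betw f (fst H) K"
    using assms by (metis finite_same_card_bij)
  have "f ` e \<in> snd G" if "e \<in> snd H" for e
  proof -
    have "f ` e \<in> [K]\<^bsup>2\<^esup>"
      using bij_betw_nsets[OF f, of 2] that assms(2) by (auto simp: bij_betw_def)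
    then show ?thesis using assms(6) by blast
  qed
  then show ?thesis
    using f assms(3) unfolding contains_copy_def bij_betw_def by blast
qed

lemma ex_ramsey_property:
  assumes "finite (fst G)" "snd G \<subseteq> [fst G]\<^bsup>2\<^esup>" "finite (fst H)" "snd H \<subseteq> [fst H]\<^bsup>2\<^esup>"
  shows "\<exists>N. ramsey_property N G H"
proof -
  obtain r where r: "\<forall>(V :: nat set) E. finite V \<and> card V \<ge> r \<longrightarrow>
      (\<exists>R \<subseteq> V. card R = card (fst G) \<and> clique R E \<or> card R = card (fst H) \<and> indep R E)"
    using ramsey2[of "card (fst G)" "card (fst H)"] by blast
  have "ramsey_property r G H"
    unfolding ramsey_property_def
  proof (intro allI impI)
    fix Red :: "nat set set"
    assume "Red \<subseteq> snd (complete_sgraph r)"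
    obtain K where K: "K \<subseteq> {..<r}"
      and K': "card K = card (fst G) \<and> clique K Red \<or> card K = card (fst H) \<and> indep K Red"
      using r[rule_format, of "{..<r}" Red] by auto
    have fin: "finite K" using K finite_subset by blast
    from K' show "contains_copy ({..<r}, Red) G \<or> contains_copy (complement_sgraph ({..<r}, Red)) H"
    proof
      assume a: "card K = card (fst G) \<and> clique K Red"
      then have "[K]\<^bsup>2\<^esup> \<subseteq> Red" by (auto simp: clique_def elim!: nsets2_E)
      then have "contains_copy ({..<r}, Red) G"
        using a assms K fin by (intro contains_copy_of_clique[of _ K]) auto
      then show ?thesis ..
    next
      assume a: "card K = card (fst H) \<and> indep K Red"
      then have "[K]\<^bsup>2\<^esup> \<subseteq> [{..<r}]\<^bsup>2\<^esup> - Red"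
        using nsets_mono[OF K, of 2] by (auto simp: indep_def elim!: nsets2_E)
      then have "contains_copy (complement_sgraph ({..<r}, Red)) H"
        using a assms K fin
        by (intro contains_copy_of_clique[of _ K]) (auto simp: complement_sgraph_def)
      then show ?thesis ..
    qed
  qed
  then show ?thesis ..
qed

definition hadamard_mat :: "nat \<Rightarrow> int mat \<Rightarrow> bool" where
  "hadamard_mat N H \<longleftrightarrow>
     H \<in> carrier_mat N N \<and>
     (\<forall>i<N. \<forall>j<N. H $$ (i, j) \<in> {1, -1}) \<and>
     H * transpose_mat H = int N \<cdot>\<^sub>m 1\<^sub>m N"

definition symmetric_mat :: "'a mat \<Rightarrow> bool" where
  "symmetric_mat A \<longleftrightarrow> A = transpose_mat A"

end

theory Submission
  imports Defs
begin

text \<open>Let \<open>m = 2n - 2\<close>. Double the Hadamard matrix \<open>H\<close> to the \<open>2m \<times> 2m\<close> sign matrix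
  \<open>K = H \<otimes> ((1, -1), (-1, 1))\<close> and colour \<open>xy\<close> red iff \<open>K x y = 1\<close>. The rows of \<open>K\<close> sum to
  \<open>0\<close> and distinct rows have inner product \<open>0\<close> or \<open>-2m\<close>, so summing \<open>(1 \<plusminus> K x w) (1 \<plusminus> K y w)\<close>
  over \<open>w\<close> shows that at most \<open>m/2 = n - 1\<close> columns \<open>w\<close> satisfy \<open>K x w = K y w = 1\<close>, and likewise for
  \<open>-1\<close>. Since \<open>K x x = 1\<close>, the ends of a red edge \<open>xy\<close> are themselves two such columns, which leaves
  at most \<open>n - 3\<close> red common neighbours.\<close>

lemma contains_copy_mono:
  assumes "contains_copy G H" "fst G \<subseteq> fst G'" "snd G \<subseteq> snd G'"
  shows "contains_copy G' H"
  using assms unfolding contains_copy_def by blast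

text \<open>A colouring on \<open>M\<close> vertices restricts to the first \<open>N\<close>, where
  both colour classes only shrink. This is what lets failure at a single \<open>N\<close> exclude
  every smaller value in the \<open>LEAST\<close> defining \<open>ramsey_number\<close>.\<close>

lemma ramsey_property_mono:
  assumes "ramsey_property N G H" "N \<le> M"
  shows "ramsey_property M G H"
  unfolding ramsey_property_def
proof (intro allI impI)
  fix Red :: "nat set set"
  assume Red: "Red \<subseteq> snd (complete_sgraph M)"
  have sub: "[{..<N}]\<^bsup>2\<^esup> \<subseteq> [{..<M}]\<^bsup>2\<^esup>"
    using assms(2) by (intro nsets_mono) auto
  let ?Red = "Red \<inter> [{..<N}]\<^bsup>2\<^esup>"
  have "contains_copy ({..<N}, ?Red) G \<or> contains_copy (complement_sgraph ({..<N}, ?Red)) H"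
    using assms(1) unfolding ramsey_property_def complete_sgraph_def by simp
  then show "contains_copy ({..<M}, Red) G \<or> contains_copy (complement_sgraph ({..<M}, Red)) H"
  proof (rule disj_forward)
    show "contains_copy ({..<M}, Red) G" if "contains_copy ({..<N}, ?Red) G"
      using that assms(2) by (auto elim: contains_copy_mono)
    show "contains_copy (complement_sgraph ({..<M}, Red)) H"
      if "contains_copy (complement_sgraph ({..<N}, ?Red)) H"
      using that sub assms(2) by (auto elim!: contains_copy_mono simp: complement_sgraph_def)
  qed
qed

lemma less_ramsey_number:
  assumes "finite (fst G)" "snd G \<subseteq> [fst G]\<^bsup>2\<^esup>" "finite (fst H)" "snd H \<subseteq> [fst H]\<^bsup>2\<^esup>"
    and "\<not> ramsey_property N G H"
  shows "N < ramsey_number G H"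
proof -
  have "ramsey_property (ramsey_number G H) G H"
    unfolding ramsey_number_def using ex_ramsey_property[OF assms(1-4)] by (rule LeastI_ex)
  then show ?thesis
    using ramsey_property_mono assms(5) not_less by blast
qed

lemma finite_book: "finite (fst (book_sgraph k))"
  by (simp add: book_sgraph_def join_sgraph_def complement_sgraph_def complete_sgraph_def)

lemma book_edges_subset: "snd (book_sgraph k) \<subseteq> [fst (book_sgraph k)]\<^bsup>2\<^esup>"
  by (auto simp: book_sgraph_def join_sgraph_def complement_sgraph_def complete_sgraph_def
      nsets_def card_image)

text \<open>Reduces a book to counting common neighbours: \<open>u\<close>, \<open>v\<close> are the
  images of the spine and \<open>W\<close> is the set of pages.\<close>

lemma contains_copy_bookE:
  assumes "contains_copy G (book_sgraph k)"
  obtains u v W where "u \<noteq> v" "u \<in> fst G" "v \<in> fst G" "{u, v} \<in> snd G"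
    "W \<subseteq> fst G - {u, v}" "finite W" "card W = k" "\<And>w. w \<in> W \<Longrightarrow> {u, w} \<in> snd G \<and> {v, w} \<in> snd G"
proof -
  let ?V = "{..<2::nat} <+> {..<k}"
  have "fst (book_sgraph k) = ?V"
    by (simp add: book_sgraph_def join_sgraph_def complement_sgraph_def complete_sgraph_def)
  then obtain f where f: "inj_on f ?V" "f ` ?V \<subseteq> fst G"
    and e: "\<And>e. e \<in> snd (book_sgraph k) \<Longrightarrow> f ` e \<in> snd G"
    using assms unfolding contains_copy_def by auto
  have inj: "f (Inl 0) \<noteq> f (Inl 1)"
    "\<And>i j. i < k \<Longrightarrow> j < k \<Longrightarrow> f (Inr i) = f (Inr j) \<longleftrightarrow> i = j"
    "\<And>i a. i < k \<Longrightarrow> a < 2 \<Longrightarrow> f (Inr i) \<noteq> f (Inl a)"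
    using f(1) by (auto dest: inj_onD)
  let ?u = "f (Inl 0)" and ?v = "f (Inl 1)" and ?W = "(\<lambda>i. f (Inr i)) ` {..<k}"
  have "{0, 1::nat} \<in> [{..<2}]\<^bsup>2\<^esup>"
    by (auto simp: nsets_def)
  then have "Inl ` {0, 1::nat} \<in> snd (book_sgraph k)"
    unfolding book_sgraph_def join_sgraph_def complete_sgraph_def by auto
  from e[OF this] have uv: "{?u, ?v} \<in> snd G"
    by simp
  have spoke: "{f (Inl a), f (Inr i)} \<in> snd G" if "a < 2" "i < k" for a i
  proof -
    have "{Inl a, Inr i} \<in> snd (book_sgraph k)"
      using that
      by (auto simp: book_sgraph_def join_sgraph_def complement_sgraph_def complete_sgraph_def)
    from e[OF this] show ?thesis by simp
  qed
  have "inj_on (\<lambda>i. f (Inr i)) {..<k}"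
    by (auto simp: inj_on_def inj)
  then have "card ?W = k"
    by (simp add: card_image)
  moreover have "?W \<subseteq> fst G - {?u, ?v}"
    using f(2) by (auto simp: inj)
  moreover have "?u \<noteq> ?v" "?u \<in> fst G" "?v \<in> fst G"
    using inj(1) by (auto intro!: subsetD[OF f(2)])
  ultimately show thesis
    using uv spoke by (intro that[of ?u ?v ?W]) auto
qed

lemma card_common_sign_le:
  fixes a b :: "'a \<Rightarrow> int" and s :: int
  assumes "finite V" "s \<in> {1, -1}"
    and "\<And>w. w \<in> V \<Longrightarrow> a w \<in> {1, -1}" "\<And>w. w \<in> V \<Longrightarrow> b w \<in> {1, -1}"
    and "sum a V = 0" "sum b V = 0" "(\<Sum>w\<in>V. a w * b w) \<le> 0"
  shows "4 * card {w \<in> V. a w = s \<and> b w = s} \<le> card V"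
proof -
  have "int (4 * card {w \<in> V. a w = s \<and> b w = s}) = (\<Sum>w\<in>V. if a w = s \<and> b w = s then 4 else 0)"
    using assms(1) by (simp flip: sum.inter_filter)
  \<comment> \<open>Each factor is 2 where the sign equals \<open>s\<close> and 0 elsewhere.\<close>
  also have "\<dots> = (\<Sum>w\<in>V. (1 + s * a w) * (1 + s * b w))"
    using assms(2-4) by (intro sum.cong) fastforce+
  \<comment> \<open>Here \<open>s * s = 1\<close> removes the sign from the product term.\<close>
  also have "\<dots> = (\<Sum>w\<in>V. 1 + s * a w + s * b w + a w * b w)"
    using assms(2) by (intro sum.cong) (auto simp: algebra_simps)
  also have "\<dots> = int (card V) + s * sum a V + s * sum b V + (\<Sum>w\<in>V. a w * b w)"
    by (simp add: sum.distrib sum_distrib_left)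
  also have "\<dots> \<le> int (card V)"
    using assms(5-7) by simp
  finally show ?thesis by linarith
qed

text \<open>In block form, \<open>H\<close> stands in the two diagonal blocks and \<open>-H\<close>
  in the other two. For indices below \<open>2 * m\<close>, the test \<open>x < m\<close> selects
  the block and \<open>x mod m\<close> the position in it.\<close>

definition double_cover :: "nat \<Rightarrow> int mat \<Rightarrow> nat \<Rightarrow> nat \<Rightarrow> int" where
  "double_cover m H x y =
    (if x < m \<longleftrightarrow> y < m then 1 else -1) * H $$ (x mod m, y mod m)"

lemma sum_lessThan_double:
  fixes f :: "nat \<Rightarrow> 'a::comm_monoid_add"
  shows "(\<Sum>w<2 * m. f w) = (\<Sum>j<m. f j + f (m + j))"
proof -
  have "(\<Sum>w<2 * m. f w) = (\<Sum>w<m. f w) + (\<Sum>w=m..<m + m. f w)"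
    by (simp add: lessThan_atLeast0 sum.atLeastLessThan_concat mult_2)
  also have "(\<Sum>w=m..<m + m. f w) = (\<Sum>j<m. f (m + j))"
    using sum.shift_bounds_nat_ivl[of f 0 m m]
    by (simp add: lessThan_atLeast0 add.commute)
  finally show ?thesis by (simp add: sum.distrib)
qed

text \<open>Columns \<open>j\<close> and \<open>m + j\<close> carry opposite entries and
  cancel.\<close>

lemma sum_double_cover: "(\<Sum>w<2 * m. double_cover m H x w) = 0"
  unfolding sum_lessThan_double by (intro sum.neutral) (simp add: double_cover_def)

lemma hadamard_row_inner:
  assumes "hadamard_mat m H" "i < m" "j < m"
  shows "(\<Sum>k<m. H $$ (i, k) * H $$ (j, k)) = (if i = j then int m else 0)"
proof -
  have H: "H \<in> carrier_mat m m" "H * transpose_mat H = int m \<cdot>\<^sub>m 1\<^sub>m m"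
    using assms(1) by (auto simp: hadamard_mat_def)
  have "(H * transpose_mat H) $$ (i, j) = (\<Sum>k<m. H $$ (i, k) * H $$ (j, k))"
    using H(1) assms(2,3) by (simp add: scalar_prod_def lessThan_atLeast0)
  then show ?thesis
    using H(2) assms(2,3) by (cases "i = j") simp_all
qed

text \<open>Columns \<open>j\<close> and \<open>m + j\<close> contribute equally, so the sum is
  \<open>2 * s\<close> times an inner product of rows of \<open>H\<close>. This is nonzero only for
  equal residues, and distinct \<open>x\<close>, \<open>y\<close> with equal residues lie in
  different blocks, where \<open>s = -1\<close>.\<close>

lemma double_cover_inner_nonpos:
  assumes "hadamard_mat m H" "x < 2 * m" "y < 2 * m" "x \<noteq> y"
  shows "(\<Sum>w<2 * m. double_cover m H x w * double_cover m H y w) \<le> 0"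
proof -
  define s :: int where "s = (if x < m \<longleftrightarrow> y < m then 1 else -1)"
  have m: "x mod m < m" "y mod m < m"
    using assms(2) by auto
  have "(\<Sum>w<2 * m. double_cover m H x w * double_cover m H y w)
      = (\<Sum>j<m. 2 * s * (H $$ (x mod m, j) * H $$ (y mod m, j)))"
    unfolding sum_lessThan_double by (intro sum.cong) (auto simp: double_cover_def s_def)
  also have "\<dots> = 2 * s * (if x mod m = y mod m then int m else 0)"
    using hadamard_row_inner[OF assms(1) m] by (simp only: flip: sum_distrib_left)
  also have "\<dots> \<le> 0"
  proof (cases "x mod m = y mod m")
    case True
    then have "\<not> (x < m \<longleftrightarrow> y < m)"
      using assms(2-4) by (auto simp: mod_if split: if_splits)
    then show ?thesis by (simp add: s_def)
  qed simp
  finally show ?thesis .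
qed

lemma double_cover_sign:
  assumes "hadamard_mat m H" "x < 2 * m"
  shows "double_cover m H x y \<in> {1, -1}"
proof -
  have "H $$ (x mod m, y mod m) \<in> {1, -1}"
    using assms by (auto simp: hadamard_mat_def)
  then show ?thesis by (auto simp: double_cover_def)
qed

lemma double_cover_commute:
  assumes "hadamard_mat m H" "symmetric_mat H" "x < 2 * m"
  shows "double_cover m H x y = double_cover m H y x"
proof -
  \<comment> \<open>The bound on \<open>x\<close> forces \<open>m > 0\<close>, so
    \<open>y mod m\<close> is a valid index for any \<open>y\<close>.\<close>
  have "transpose_mat H $$ (x mod m, y mod m) = H $$ (y mod m, x mod m)"
    using assms by (intro index_transpose_mat) (auto simp: hadamard_mat_def)
  then show ?thesis
    using assms(2) by (auto simp: double_cover_def symmetric_mat_def)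
qed

lemma card_double_cover_common_le:
  assumes "hadamard_mat m H" "x < 2 * m" "y < 2 * m" "x \<noteq> y" "s \<in> {1, -1}"
  shows "2 * card {w \<in> {..<2 * m}. double_cover m H x w = s \<and> double_cover m H y w = s} \<le> m"
  using card_common_sign_le[of "{..<2 * m}" s "double_cover m H x" "double_cover m H y"]
    double_cover_sign[OF assms(1)] sum_double_cover double_cover_inner_nonpos[OF assms(1-4)] assms
  by simp

theorem lemma1p1:
  fixes n :: nat
  assumes "n \<ge> 3" and "n \<noteq> 6"
    and "\<exists>H :: int mat. hadamard_mat (2 * n - 2) H \<and> symmetric_mat H
           \<and> (\<forall>i < 2 * n - 2. H $$ (i, i) = 1)"
  shows "ramsey_number (book_sgraph (n - 2)) (book_sgraph n) \<ge> 4 * n - 3"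
proof -
  define m where "m = 2 * n - 2"
  obtain H where H: "hadamard_mat m H" "symmetric_mat H" "\<And>i. i < m \<Longrightarrow> H $$ (i, i) = 1"
    using assms(3) unfolding m_def by blast
  define K where "K = double_cover m H"
  define Red where "Red = {{x, y} | x y. x < 2 * m \<and> y < 2 * m \<and> x \<noteq> y \<and> K x y = 1}"
  let ?G = "({..<2 * m}, Red)"
  have commute: "K x y = K y x" if "x < 2 * m" for x y
    unfolding K_def using H(1,2) that by (rule double_cover_commute)
  have diag: "K x x = 1" if "x < 2 * m" for x
    using that H(3)[of "x mod m"] by (simp add: K_def double_cover_def)
  have Red_iff: "{x, y} \<in> Red \<longleftrightarrow> x \<noteq> y \<and> K x y = 1" if "x < 2 * m" "y < 2 * m" for x y
    using that commute by (auto simp: Red_def doubleton_eq_iff)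
  have Blue: "K x y = -1" if "x < 2 * m" "y < 2 * m" "{x, y} \<in> snd (complement_sgraph ?G)" for x y
    using that Red_iff[of x y] double_cover_sign[OF H(1), of x y]
    by (auto simp: K_def complement_sgraph_def nsets_def card_2_iff doubleton_eq_iff)
  have common: "card W \<le> n - 1"
    if "x < 2 * m" "y < 2 * m" "x \<noteq> y" "s \<in> {1, -1}"
      "W \<subseteq> {w \<in> {..<2 * m}. K x w = s \<and> K y w = s}" for x y s W
    using card_double_cover_common_le[OF H(1) that(1-4)] card_mono[OF _ that(5)]
    by (simp add: K_def m_def)
  have no_red: "\<not> contains_copy ?G (book_sgraph (n - 2))"
  proof
    assume "contains_copy ?G (book_sgraph (n - 2))"
    then obtain u v W where uv: "u \<noteq> v" "u < 2 * m" "v < 2 * m" "{u, v} \<in> Red"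
      and W: "W \<subseteq> {..<2 * m} - {u, v}" "finite W" "card W = n - 2"
        "\<And>w. w \<in> W \<Longrightarrow> {u, w} \<in> Red \<and> {v, w} \<in> Red"
      by (elim contains_copy_bookE) auto
    \<comment> \<open>The spine ends count too: \<open>K u u = K v v = 1\<close> by
      \<open>diag\<close>, and \<open>K u v = 1\<close> because the spine is red.\<close>
    have "insert u (insert v W) \<subseteq> {w \<in> {..<2 * m}. K u w = 1 \<and> K v w = 1}"
      using W(1,4) uv Red_iff commute[of u v] diag by auto
    then have "card (insert u (insert v W)) \<le> n - 1"
      using uv by (intro common[of u v 1]) auto
    moreover have "card (insert u (insert v W)) = n"
      using W(1-3) uv(1) assms(1) by (subst card_insert_disjoint; auto)+
    ultimately show False using assms(1) by simp
  qed
  have no_blue: "\<not> contains_copy (complement_sgraph ?G) (book_sgraph n)"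
  proof
    assume "contains_copy (complement_sgraph ?G) (book_sgraph n)"
    then obtain u v W where uv: "u \<noteq> v" "u < 2 * m" "v < 2 * m"
      and W: "W \<subseteq> {..<2 * m} - {u, v}" "card W = n"
        "\<And>w. w \<in> W \<Longrightarrow> {u, w} \<in> snd (complement_sgraph ?G) \<and> {v, w} \<in> snd (complement_sgraph ?G)"
      by (elim contains_copy_bookE) (auto simp: complement_sgraph_def)
    \<comment> \<open>The diagonal is positive, so only the pages are counted here; already
      \<open>n\<close> of them exceed \<open>n - 1\<close>.\<close>
    have "W \<subseteq> {w \<in> {..<2 * m}. K u w = -1 \<and> K v w = -1}"
      using W(1,3) uv Blue by auto
    then have "card W \<le> n - 1"
      using uv by (intro common[of u v "-1"]) auto
    then show False using W(2) assms(1) by simp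
  qed
  have "Red \<subseteq> snd (complete_sgraph (2 * m))"
    by (auto simp: Red_def complete_sgraph_def nsets_def)
  then have "\<not> ramsey_property (2 * m) (book_sgraph (n - 2)) (book_sgraph n)"
    using no_red no_blue unfolding ramsey_property_def by blast
  \<comment> \<open>As \<open>2 * m = 4 * n - 4\<close>, the strict inequality supplies the last
    unit.\<close>
  then have "2 * m < ramsey_number (book_sgraph (n - 2)) (book_sgraph n)"
    by (intro less_ramsey_number finite_book book_edges_subset)
  then show ?thesis
    using assms(1) unfolding m_def by simp
qed

end
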